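(* For every $q\in\{2,3\}$, $\varepsilon=\pm1$ and integer $m\ge 3$, the graph $\mathrm{NO}^\varepsilon_{2m}(q)$ is not triply transitive.
   Context: Let $V=\mathbb F_q^{2m}$ carry a non-degenerate quadratic form $Q$ of type $\varepsilon$ (hyperbolic if $\varepsilon=+1$, elliptic if $\varepsilon=-1$), with associated bilinear form. For $q=2$, $\mathrm{NO}^\varepsilon_{2m}(2)$ is the graph on the non-singular $1$-dimensional subspaces of $V$, two being adjacent iff they are orthogonal. For $q=3$, $\mathrm{NO}^\varepsilon_{2m}(3)$ is the graph on one class of non-isotropic points (those $\langle x\rangle$ with $Q(x)$ in a fixed square class), two being adjacent iff they are orthogonal. For a strongly regular graph $\Gamma=(W,E)$: $A_0=I$, $A_1$ its adjacency matrix, $A_2=J-I-A_1$; for a vertex $\omega$, $E^*_{i,\omega}$ ($i=0,1,2$) is the diagonal matrix whose diagonal is the $\omega$-row of $A_i$; $T_\omega$ is the algebra generated by $A_0,A_1,A_2,E^*_{0,\omega},E^*_{1,\omega},E^*_{2,\omega}$; $T_{0,\omega}$ is the span of all $E^*_{i,\omega}A_jE^*_{k,\omega}$; $\tilde T_\omega$ is the algebra of complex matrices commuting with the permutation matrices of the stabilizer $G_\omega$ in $G=\mathrm{Aut}(\Gamma)$. $\Gamma$ is triply transitive if $G$ is transitive and $T_{0,\omega}=T_\omega=\tilde T_\omega$ for some (equivalently every) vertex $\omega$. *)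

theory Defs
  imports "HOL-Analysis.Analysis" "HOL-Combinatorics.Permutations"
begin

section \<open>Quadratic forms\<close>

definition polar :: "('k::field ^ 'n \<Rightarrow> 'k) \<Rightarrow> 'k ^ 'n \<Rightarrow> 'k ^ 'n \<Rightarrow> 'k" where
  "polar Q x y = Q (x + y) - Q x - Q y"

definition quadratic_form :: "('k::field ^ 'n \<Rightarrow> 'k) \<Rightarrow> bool" where
  "quadratic_form Q \<longleftrightarrow>
     (\<forall>a x. Q (a *s x) = a ^ 2 * Q x) \<and>
     (\<forall>x. Vector_Spaces.linear (*s) (*) (\<lambda>y. polar Q x y)) \<and>
     (\<forall>y. Vector_Spaces.linear (*s) (*) (\<lambda>x. polar Q x y))"

definition nondegenerate :: "('k::field ^ 'n \<Rightarrow> 'k) \<Rightarrow> bool" where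
  "nondegenerate Q \<longleftrightarrow> (\<forall>x. (\<forall>y. polar Q x y = 0) \<longrightarrow> x = 0)"

definition totally_singular :: "('k::field ^ 'n \<Rightarrow> 'k) \<Rightarrow> ('k ^ 'n) set \<Rightarrow> bool" where
  "totally_singular Q S \<longleftrightarrow> vec.subspace S \<and> (\<forall>x\<in>S. Q x = 0)"

definition witt_index :: "('k::field ^ 'n \<Rightarrow> 'k) \<Rightarrow> nat" where
  "witt_index Q = Max {vec.dim S | S. totally_singular Q S}"

text \<open>In dimension \<open>2m\<close>, a hyperbolic form has Witt index \<open>m\<close> and an elliptic one has
  Witt index \<open>m - 1\<close>.\<close>

definition hyperbolic :: "('k::field ^ 'n \<Rightarrow> 'k) \<Rightarrow> bool" where
  "hyperbolic Q \<longleftrightarrow> nondegenerate Q \<and> CARD('n) = 2 * witt_index Q"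

definition elliptic :: "('k::field ^ 'n \<Rightarrow> 'k) \<Rightarrow> bool" where
  "elliptic Q \<longleftrightarrow> nondegenerate Q \<and> CARD('n) = 2 * (witt_index Q + 1)"

definition has_type :: "('k::field ^ 'n \<Rightarrow> 'k) \<Rightarrow> int \<Rightarrow> bool" where
  "has_type Q \<epsilon> \<longleftrightarrow> (\<epsilon> = 1 \<and> hyperbolic Q) \<or> (\<epsilon> = -1 \<and> elliptic Q)"


section \<open>The graphs \<open>NO\<close>\<close>

definition points :: "('k::field ^ 'n) set set" where
  "points = {P. vec.subspace P \<and> vec.dim P = 1}"

definition nonsingular_points :: "('k::field ^ 'n \<Rightarrow> 'k) \<Rightarrow> ('k ^ 'n) set set" where
  "nonsingular_points Q = {P \<in> points. \<forall>x\<in>P. x \<noteq> 0 \<longrightarrow> Q x \<noteq> 0}"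

definition square_class :: "'k::field \<Rightarrow> 'k set" where
  "square_class c = {c * a ^ 2 | a. a \<noteq> 0}"

definition class_points :: "('k::field ^ 'n \<Rightarrow> 'k) \<Rightarrow> 'k \<Rightarrow> ('k ^ 'n) set set" where
  "class_points Q c = {P \<in> points. \<forall>x\<in>P. x \<noteq> 0 \<longrightarrow> Q x \<in> square_class c}"

text \<open>The parameter \<open>c \<noteq> 0\<close> selects the square class over the field with three elements; it plays
  no role over the field with two elements.\<close>

definition NO_vertices :: "('k::field ^ 'n \<Rightarrow> 'k) \<Rightarrow> 'k \<Rightarrow> ('k ^ 'n) set set" where
  "NO_vertices Q c = (if CARD('k) = 2 then nonsingular_points Q else class_points Q c)"

text \<open>Distinctness has to be required: over the field with two elements every vector is orthogonal
  to itself.\<close>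

definition NO_adj :: "('k::field ^ 'n \<Rightarrow> 'k) \<Rightarrow> ('k ^ 'n) set \<Rightarrow> ('k ^ 'n) set \<Rightarrow> bool" where
  "NO_adj Q P R \<longleftrightarrow> P \<noteq> R \<and> (\<forall>x\<in>P. \<forall>y\<in>R. polar Q x y = 0)"


section \<open>Terwilliger algebras and triple transitivity\<close>

text \<open>A graph is given by a vertex set \<open>W\<close> in a finite type \<open>'v\<close> and an adjacency relation. A
  matrix indexed by \<open>W\<close> is represented by the matrix indexed by all of \<open>'v\<close> that has zero entries
  outside \<open>W \<times> W\<close>; in particular the identity matrix is \<open>idmat W\<close>, not \<open>mat 1\<close>. Sums and products
  of such matrices are those of the matrices indexed by \<open>W\<close>.\<close>

definition supported_on :: "'v::finite set \<Rightarrow> complex ^ 'v ^ 'v \<Rightarrow> bool" where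
  "supported_on W M \<longleftrightarrow> (\<forall>x y. M $ x $ y \<noteq> 0 \<longrightarrow> x \<in> W \<and> y \<in> W)"

definition idmat :: "'v::finite set \<Rightarrow> complex ^ 'v ^ 'v" where
  "idmat W = (\<chi> x y. of_bool (x \<in> W \<and> x = y))"

definition allones :: "'v::finite set \<Rightarrow> complex ^ 'v ^ 'v" where
  "allones W = (\<chi> x y. of_bool (x \<in> W \<and> y \<in> W))"

definition adjmat :: "'v::finite set \<Rightarrow> ('v \<Rightarrow> 'v \<Rightarrow> bool) \<Rightarrow> complex ^ 'v ^ 'v" where
  "adjmat W adj = (\<chi> x y. of_bool (x \<in> W \<and> y \<in> W \<and> adj x y))"

text \<open>The matrices \<open>A\<^sub>0, A\<^sub>1, A\<^sub>2\<close> and \<open>E\<^sup>*\<^sub>0, E\<^sup>*\<^sub>1, E\<^sup>*\<^sub>2\<close>; the index \<open>i\<close> is always restricted to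
  \<open>{0, 1, 2}\<close>.\<close>

definition Amat :: "'v::finite set \<Rightarrow> ('v \<Rightarrow> 'v \<Rightarrow> bool) \<Rightarrow> nat \<Rightarrow> complex ^ 'v ^ 'v" where
  "Amat W adj i =
     (if i = 0 then idmat W
      else if i = 1 then adjmat W adj
      else allones W - idmat W - adjmat W adj)"

definition Emat :: "'v::finite set \<Rightarrow> ('v \<Rightarrow> 'v \<Rightarrow> bool) \<Rightarrow> 'v \<Rightarrow> nat \<Rightarrow> complex ^ 'v ^ 'v" where
  "Emat W adj w i = (\<chi> x y. if x = y then Amat W adj i $ w $ x else 0)"

definition mat_scale :: "complex \<Rightarrow> complex ^ 'v ^ 'v \<Rightarrow> complex ^ 'v ^ 'v" where
  "mat_scale a M = (\<chi> x y. a * M $ x $ y)"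

global_interpretation cmat: vector_space "mat_scale :: complex \<Rightarrow> complex ^ 'v ^ 'v \<Rightarrow> complex ^ 'v ^ 'v"
  by standard (simp_all add: mat_scale_def vec_eq_iff algebra_simps)

inductive_set generated_algebra :: "(complex ^ 'v ^ 'v) set \<Rightarrow> (complex ^ 'v::finite ^ 'v) set"
  for S where
  gen: "M \<in> S \<Longrightarrow> M \<in> generated_algebra S"
| zero: "0 \<in> generated_algebra S"
| add: "M \<in> generated_algebra S \<Longrightarrow> N \<in> generated_algebra S \<Longrightarrow> M + N \<in> generated_algebra S"
| scale: "M \<in> generated_algebra S \<Longrightarrow> mat_scale a M \<in> generated_algebra S"
| mult: "M \<in> generated_algebra S \<Longrightarrow> N \<in> generated_algebra S \<Longrightarrow> M ** N \<in> generated_algebra S"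

definition terwilliger :: "'v::finite set \<Rightarrow> ('v \<Rightarrow> 'v \<Rightarrow> bool) \<Rightarrow> 'v \<Rightarrow> (complex ^ 'v ^ 'v) set" where
  "terwilliger W adj w =
     generated_algebra ({Amat W adj i | i. i \<le> 2} \<union> {Emat W adj w i | i. i \<le> 2})"

definition terwilliger0 :: "'v::finite set \<Rightarrow> ('v \<Rightarrow> 'v \<Rightarrow> bool) \<Rightarrow> 'v \<Rightarrow> (complex ^ 'v ^ 'v) set" where
  "terwilliger0 W adj w =
     cmat.span {Emat W adj w i ** Amat W adj j ** Emat W adj w k | i j k. i \<le> 2 \<and> j \<le> 2 \<and> k \<le> 2}"

definition automorphisms :: "'v set \<Rightarrow> ('v \<Rightarrow> 'v \<Rightarrow> bool) \<Rightarrow> ('v \<Rightarrow> 'v) set" where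
  "automorphisms W adj = {g. g permutes W \<and> (\<forall>x\<in>W. \<forall>y\<in>W. adj (g x) (g y) \<longleftrightarrow> adj x y)}"

definition vertex_transitive :: "'v set \<Rightarrow> ('v \<Rightarrow> 'v \<Rightarrow> bool) \<Rightarrow> bool" where
  "vertex_transitive W adj \<longleftrightarrow> (\<forall>x\<in>W. \<forall>y\<in>W. \<exists>g\<in>automorphisms W adj. g x = y)"

definition stabilizer :: "'v set \<Rightarrow> ('v \<Rightarrow> 'v \<Rightarrow> bool) \<Rightarrow> 'v \<Rightarrow> ('v \<Rightarrow> 'v) set" where
  "stabilizer W adj w = {g \<in> automorphisms W adj. g w = w}"

definition permmat :: "'v::finite set \<Rightarrow> ('v \<Rightarrow> 'v) \<Rightarrow> complex ^ 'v ^ 'v" where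
  "permmat W g = (\<chi> x y. of_bool (y \<in> W \<and> x = g y))"

definition centralizer_algebra ::
    "'v::finite set \<Rightarrow> ('v \<Rightarrow> 'v \<Rightarrow> bool) \<Rightarrow> 'v \<Rightarrow> (complex ^ 'v ^ 'v) set" where
  "centralizer_algebra W adj w =
     {M. supported_on W M \<and> (\<forall>g\<in>stabilizer W adj w. permmat W g ** M = M ** permmat W g)}"

definition triply_transitive :: "'v::finite set \<Rightarrow> ('v \<Rightarrow> 'v \<Rightarrow> bool) \<Rightarrow> bool" where
  "triply_transitive W adj \<longleftrightarrow>
     vertex_transitive W adj \<and>
     (\<exists>w\<in>W. terwilliger0 W adj w = terwilliger W adj w \<and>
            terwilliger W adj w = centralizer_algebra W adj w)"

end

theory Submission
  imports Defs
begin

text \<open>If \<open>T\<^sub>0 = T\<close>, then the number of common neighbours of three vertices \<open>w, x, y\<close> depends only on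
  the relations between them. In the graphs \<open>NO\<close> this fails: if \<open>\<langle>w\<rangle>, \<langle>x\<rangle>, \<langle>w + x\<rangle>\<close> are pairwise
  non-adjacent vertices, then every common neighbour of the first two is a neighbour of the third,
  whereas this is false for some \<open>\<langle>t\<rangle>\<close> that is likewise non-adjacent to \<open>\<langle>w\<rangle>\<close> and \<open>\<langle>x\<rangle>\<close>.\<close>

section \<open>Common neighbours of three vertices\<close>

lemma Emat_mult_nth:
  "(Emat W adj w i ** M ** Emat W adj w k) $ x $ y
     = Amat W adj i $ w $ x * M $ x $ y * Amat W adj k $ w $ y"
  by (simp add: matrix_matrix_mult_def Emat_def if_distrib[where f="\<lambda>a. a * _"]
      if_distrib[where f="\<lambda>a. _ * a"] sum.delta sum.delta' cong: if_cong)

text \<open>An entry of a spanning matrix is a product of entries of the \<open>Amat\<close> at (w,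
  x), (x, y) and (w, y), so linear combinations see only the relations among the three
  vertices.\<close>

lemma terwilliger0_nth_eq:
  assumes M: "M \<in> terwilliger0 W adj w"
    and w: "\<And>k. Amat W adj k $ w $ y = Amat W adj k $ w $ y'"
    and x: "\<And>j. Amat W adj j $ x $ y = Amat W adj j $ x $ y'"
  shows "M $ x $ y = M $ x $ y'"
  using M unfolding terwilliger0_def
proof (induction rule: cmat.span_induct_alt)
  case base
  then show ?case by simp
next
  case (step a N L)
  then obtain i j k where "N = Emat W adj w i ** Amat W adj j ** Emat W adj w k" by blast
  then have "N $ x $ y = N $ x $ y'" by (simp add: Emat_mult_nth w x)
  then show ?case using step by (simp add: mat_scale_def)
qed

lemma Amat_nonadjacent:
  assumes "x \<in> W" "y \<in> W" "x \<noteq> y" "\<not> adj x y"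
  shows "Amat W adj i $ x $ y = of_bool (i \<noteq> 0 \<and> i \<noteq> 1)"
  using assms by (simp add: Amat_def idmat_def adjmat_def allones_def)

text \<open>The middle factor keeps those walks of length two from x to y whose middle vertex is a
  neighbour of w.\<close>

lemma adjmat_Emat_adjmat_nth:
  assumes "w \<in> W" "x \<in> W" "y \<in> W"
  shows "(Amat W adj 1 ** Emat W adj w 1 ** Amat W adj 1) $ x $ y
           = of_nat (card {z \<in> W. adj w z \<and> adj x z \<and> adj z y})"
proof -
  have "(Amat W adj 1 ** Emat W adj w 1 ** Amat W adj 1) $ x $ y
      = (\<Sum>z\<in>UNIV. Amat W adj 1 $ x $ z * Amat W adj 1 $ w $ z * Amat W adj 1 $ z $ y)"
    by (simp add: matrix_matrix_mult_def Emat_def if_distrib[where f="\<lambda>a. _ * a"]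
        sum.delta sum.delta' cong: if_cong)
  also have "\<dots> = (\<Sum>z\<in>UNIV. of_bool (z \<in> W \<and> adj w z \<and> adj x z \<and> adj z y))"
    using assms by (intro sum.cong) (auto simp: Amat_def adjmat_def)
  also have "\<dots> = of_nat (card {z \<in> W. adj w z \<and> adj x z \<and> adj z y})"
    by (simp add: sum_of_bool_eq)
  finally show ?thesis .
qed

text \<open>The matrix of these counts is a product of generators of T, hence lies in T_0, where its
  entries at (x, y) and (x, y') must agree.\<close>

lemma terwilliger0_imp_card_eq:
  assumes T: "terwilliger0 W adj w = terwilliger W adj w"
    and W: "w \<in> W" "x \<in> W" "y \<in> W" "y' \<in> W"
    and ne: "w \<noteq> y" "w \<noteq> y'" "x \<noteq> y" "x \<noteq> y'"
    and nonadj: "\<not> adj w y" "\<not> adj w y'" "\<not> adj x y" "\<not> adj x y'"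
  shows "card {z \<in> W. adj w z \<and> adj x z \<and> adj z y} = card {z \<in> W. adj w z \<and> adj x z \<and> adj z y'}"
proof -
  let ?M = "Amat W adj 1 ** Emat W adj w 1 ** Amat W adj 1"
  have "Amat W adj 1 \<in> terwilliger W adj w" "Emat W adj w 1 \<in> terwilliger W adj w"
    unfolding terwilliger_def by (rule generated_algebra.gen, force)+
  then have "?M \<in> terwilliger W adj w"
    unfolding terwilliger_def by (intro generated_algebra.mult)
  then have "?M \<in> terwilliger0 W adj w" using T by simp
  then have "?M $ x $ y = ?M $ x $ y'"
    by (rule terwilliger0_nth_eq) (use W ne nonadj in \<open>simp_all add: Amat_nonadjacent\<close>)
  then show ?thesis
    unfolding adjmat_Emat_adjmat_nth[OF W(1-3)] adjmat_Emat_adjmat_nth[OF W(1,2,4)] of_nat_eq_iff .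
qed

text \<open>The common neighbours of w and x that are adjacent to y' form a proper subset of those
  adjacent to y, because z is missing. A configuration is required at every w since triple
  transitivity provides only some base vertex.\<close>

lemma not_triply_transitiveI:
  assumes "\<And>w. w \<in> W \<Longrightarrow> \<exists>x\<in>W. \<exists>y\<in>W. \<exists>y'\<in>W. \<exists>z\<in>W.
      w \<noteq> y \<and> w \<noteq> y' \<and> x \<noteq> y \<and> x \<noteq> y' \<and>
      \<not> adj w y \<and> \<not> adj w y' \<and> \<not> adj x y \<and> \<not> adj x y' \<and>
      (\<forall>v\<in>W. adj w v \<longrightarrow> adj x v \<longrightarrow> adj v y) \<and> adj w z \<and> adj x z \<and> \<not> adj z y'"
  shows "\<not> triply_transitive W adj"
proof
  assume "triply_transitive W adj"
  then obtain w where w: "w \<in> W" and T: "terwilliger0 W adj w = terwilliger W adj w"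
    unfolding triply_transitive_def by blast
  obtain x y y' z where W: "x \<in> W" "y \<in> W" "y' \<in> W" "z \<in> W"
    and ne: "w \<noteq> y" "w \<noteq> y'" "x \<noteq> y" "x \<noteq> y'"
    and nonadj: "\<not> adj w y" "\<not> adj w y'" "\<not> adj x y" "\<not> adj x y'"
    and v: "\<forall>v\<in>W. adj w v \<longrightarrow> adj x v \<longrightarrow> adj v y"
    and z: "adj w z" "adj x z" "\<not> adj z y'"
    using assms[OF w] by blast
  have "{v \<in> W. adj w v \<and> adj x v \<and> adj v y'} \<subset> {v \<in> W. adj w v \<and> adj x v \<and> adj v y}"
    using v z W by blast
  then have "card {v \<in> W. adj w v \<and> adj x v \<and> adj v y'} < card {v \<in> W. adj w v \<and> adj x v \<and> adj v y}"
    by (intro psubset_card_mono) auto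
  then show False using terwilliger0_imp_card_eq[OF T w W(1-3) ne nonadj] by simp
qed


section \<open>Fields with two or three elements\<close>

lemma card_2_field:
  fixes a :: "'k::{field,finite}"
  assumes "CARD('k) = 2"
  shows "a = 0 \<or> a = 1" and "(2::'k) = 0"
proof -
  have "card {0, 1::'k} = CARD('k)" using assms by simp
  then have "{0, 1::'k} = UNIV" by (intro card_subset_eq) auto
  then have *: "b = 0 \<or> b = 1" for b :: 'k by blast
  show "a = 0 \<or> a = 1" by (rule *)
  show "(2::'k) = 0" using *[of 2] by (metis one_add_one add_cancel_left_left zero_neq_one)
qed

lemma card_3_field:
  fixes a :: "'k::{field,finite}"
  assumes "CARD('k) = 3"
  shows "a = 0 \<or> a = 1 \<or> a = -1" and "(2::'k) = -1"
proof -
  have ne: "(1::'k) \<noteq> -1"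
  proof
    assume 1: "(1::'k) = -1"
    \<comment> \<open>If 1 = -1, a third element b brings along a fourth one, b + 1.\<close>
    have "card {0, 1::'k} \<noteq> CARD('k)" using assms by simp
    then have "{0, 1::'k} \<noteq> UNIV" by metis
    then obtain b :: 'k where b: "b \<noteq> 0" "b \<noteq> 1" by blast
    moreover have "b + 1 \<noteq> 0" using b 1 by (metis add_eq_0_iff2)
    ultimately have "card {0, 1, b, b + 1} = 4" by simp
    moreover have "card {0, 1, b, b + 1} \<le> CARD('k)" by (intro card_mono) auto
    ultimately show False using assms by simp
  qed
  then have "card {0, 1, -1::'k} = CARD('k)" using assms by simp
  then have "{0, 1, -1::'k} = UNIV" by (intro card_subset_eq) auto
  then have *: "b = 0 \<or> b = 1 \<or> b = -1" for b :: 'k by blast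
  show "a = 0 \<or> a = 1 \<or> a = -1" by (rule *)
  show "(2::'k) = -1" using *[of 2] ne by (metis one_add_one add_cancel_left_left add_eq_0_iff2 zero_neq_one)
qed

text \<open>Makes square classes singletons and \<open>Q\<close> constant on the nonzero vectors of
  a point.\<close>

lemma card_2_3_field_power2:
  fixes a :: "'k::{field,finite}"
  assumes "CARD('k) \<in> {2, 3}" "a \<noteq> 0"
  shows "a ^ 2 = 1"
proof -
  have "a = 1 \<or> a = -1" using assms card_2_field(1)[of a] card_3_field(1)[of a] by blast
  then show ?thesis by auto
qed


section \<open>Quadratic forms\<close>

locale quadratic_space =
  fixes Q :: "('k::{field,finite}) ^ 'n::finite \<Rightarrow> 'k"
  assumes quadratic: "quadratic_form Q" and nondeg: "nondegenerate Q"
begin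

abbreviation B where "B \<equiv> polar Q"

lemma Q_scale: "Q (a *s x) = a ^ 2 * Q x"
  using quadratic by (simp add: quadratic_form_def)

lemma Q_add: "Q (x + y) = Q x + Q y + B x y"
  by (simp add: polar_def)

lemma polar_linear: "Vector_Spaces.linear (*s) (*) (B x)"
  using quadratic by (simp add: quadratic_form_def)

lemma B_commute: "B x y = B y x"
  by (simp add: polar_def add.commute)

lemma B_add_right: "B x (y + z) = B x y + B x z"
  using polar_linear by (simp add: Vector_Spaces.linear_def module_hom_def module_hom_axioms_def)

lemma B_scale_right: "B x (a *s y) = a * B x y"
  using polar_linear by (simp add: Vector_Spaces.linear_def module_hom_def module_hom_axioms_def)

lemma B_add_left: "B (y + z) x = B y x + B z x"
  using B_add_right B_commute by metis

lemma B_scale_left: "B (a *s y) x = a * B y x"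
  using B_scale_right B_commute by metis

lemma B_minus_right: "B x (- y) = - B x y"
  using B_scale_right[of x "-1" y] by (simp add: vector_smult_lneg)

lemma B_minus_left: "B (- y) x = - B y x"
  using B_minus_right B_commute by metis

lemma B_diff_left: "B (y - z) x = B y x - B z x"
  using B_add_left[of y "- z" x] by (simp add: B_minus_left)

lemma B_diff_right: "B x (y - z) = B x y - B x z"
  using B_diff_left B_commute by metis

lemma Q_minus: "Q (- x) = Q x"
  using Q_scale[of "-1" x] by (simp add: vector_smult_lneg)

lemma Q_0: "Q 0 = 0"
  using Q_scale[of 0 0] by simp

lemma B_0_left: "B 0 x = 0"
  using B_scale_left[of 0 0 x] by simp

text \<open>In characteristic 2 this makes \<open>B\<close> alternating; over three elements it
  gives \<open>B a a = - Q a\<close>.\<close>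

lemma B_self: "B x x = 2 * Q x"
proof -
  have "Q (x + x) = (1 + 1) ^ 2 * Q x"
    using Q_scale[of "1 + 1" x] by (simp only: vector_sadd_rdistrib vector_smult_lid)
  also have "\<dots> = 2 * Q x + Q x + Q x" by (simp add: power2_eq_square)
  finally show ?thesis by (simp add: polar_def)
qed

lemma Q_diff: "Q (x - y) = Q x + Q y - B x y"
  using Q_add[of x "- y"] by (simp add: Q_minus B_minus_right)

lemmas form_simps = Q_add Q_diff Q_scale B_add_left B_add_right B_scale_left B_scale_right
  B_diff_left B_diff_right

lemma ex_B_nonzero: "x \<noteq> 0 \<Longrightarrow> \<exists>y. B x y \<noteq> 0"
  using nondeg by (auto simp: nondegenerate_def)

section \<open>Orthogonal complements and projections onto them\<close>

definition perp :: "('k ^ 'n) set \<Rightarrow> ('k ^ 'n) set" where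
  "perp S = {v. \<forall>s\<in>S. B v s = 0}"

text \<open>Pigeonhole instead of dimensions: there are fewer families of values
  \<open>B v s\<close> than vectors v, so two vectors share a family and their difference is
  orthogonal to S.\<close>

lemma perp_nonzero:
  assumes "card S < CARD('n)"
  shows "\<exists>v\<in>perp S. v \<noteq> 0"
proof -
  let ?f = "\<lambda>v. \<lambda>s\<in>S. B v s"
  have "?f ` UNIV \<subseteq> S \<rightarrow>\<^sub>E (UNIV :: 'k set)" by auto
  then have "card (range ?f) \<le> card (S \<rightarrow>\<^sub>E (UNIV :: 'k set))"
    by (intro card_mono finite_PiE) auto
  also have "\<dots> = CARD('k) ^ card S" by (simp add: card_PiE)
  also have "\<dots> < CARD('k) ^ CARD('n)"
  proof -
    have "card {0, 1 :: 'k} \<le> CARD('k)" by (intro card_mono) auto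
    then show ?thesis using assms by (intro power_strict_increasing) auto
  qed
  also have "\<dots> = CARD('k ^ 'n)" by simp
  finally have "\<not> inj ?f" using card_image by (metis less_irrefl)
  then obtain v v' where "?f v = ?f v'" "v \<noteq> v'" by (auto simp: inj_def)
  then have "B v s = B v' s" if "s \<in> S" for s using that by (metis restrict_apply')
  then have "v - v' \<in> perp S" by (simp add: perp_def B_diff_left)
  then show ?thesis using \<open>v \<noteq> v'\<close> by force
qed

text \<open>This expresses, without mentioning spans, that \<open>V\<close> is the sum of the span of \<open>S\<close> and its
  orthogonal complement: \<open>y'\<close> is the projection of \<open>y\<close> to the complement.\<close>

definition splitting :: "('k ^ 'n) set \<Rightarrow> bool" where
  "splitting S \<longleftrightarrow> (\<forall>y. \<exists>y'\<in>perp S. \<forall>v\<in>perp S. B v y' = B v y)"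

lemma splitting_empty: "splitting {}"
  by (auto simp: splitting_def perp_def)

text \<open>A Gram-Schmidt step: the component along a is subtracted, which requires dividing by
  \<open>B a a\<close>.\<close>

lemma splitting_insert:
  assumes S: "splitting S" and a: "a \<in> perp S" "B a a \<noteq> 0"
  shows "splitting (insert a S)"
  unfolding splitting_def
proof
  fix y
  obtain y' where y': "y' \<in> perp S" "\<forall>v\<in>perp S. B v y' = B v y"
    using S by (auto simp: splitting_def)
  let ?y = "y' - (B y' a / B a a) *s a"
  have "?y \<in> perp (insert a S)"
    using a y' by (auto simp: perp_def B_diff_left B_scale_left)
  moreover have "\<forall>v\<in>perp (insert a S). B v ?y = B v y"
    using y' by (auto simp: perp_def B_diff_right B_scale_right)
  ultimately show "\<exists>y'\<in>perp (insert a S). \<forall>v\<in>perp (insert a S). B v y' = B v y" by blast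
qed

text \<open>Nondegeneracy passes to the complement: projecting a vector y does not change its
  pairing with v.\<close>

lemma splitting_B_nonzero:
  assumes "splitting S" "v \<in> perp S" "v \<noteq> 0"
  shows "\<exists>y\<in>perp S. B v y \<noteq> 0"
  using assms ex_B_nonzero[of v] by (metis splitting_def)

text \<open>If \<open>Q\<close> vanishes at v and y, then its value at v + y is
  \<open>B v y\<close>, which can be made nonzero.\<close>

lemma splitting_anisotropic:
  assumes S: "splitting S" "card S < CARD('n)"
  shows "\<exists>a\<in>perp S. Q a \<noteq> 0"
proof -
  obtain v where v: "v \<in> perp S" "v \<noteq> 0" using perp_nonzero S by blast
  obtain y where y: "y \<in> perp S" "B v y \<noteq> 0" using splitting_B_nonzero S v by blast
  have "v + y \<in> perp S" using v y by (auto simp: perp_def B_add_left)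
  moreover have "Q v \<noteq> 0 \<or> Q y \<noteq> 0 \<or> Q (v + y) \<noteq> 0" using y by (auto simp: Q_add)
  ultimately show ?thesis using v y by blast
qed


section \<open>Choice of the vertices\<close>

text \<open>The condition \<open>B w x = - c\<close> is what makes \<open>w + x\<close> take the value \<open>c\<close> as well.\<close>

definition witnesses :: "'k \<Rightarrow> 'k ^ 'n \<Rightarrow> 'k ^ 'n \<Rightarrow> 'k ^ 'n \<Rightarrow> 'k ^ 'n \<Rightarrow> bool" where
  "witnesses c w x t z \<longleftrightarrow> Q x = c \<and> B w x = - c \<and> (\<forall>a. x \<noteq> a *s w) \<and>
     Q t = c \<and> B w t \<noteq> 0 \<and> B x t \<noteq> 0 \<and> Q z = c \<and> B w z = 0 \<and> B x z = 0 \<and> B z t \<noteq> 0"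

lemma witnesses_card_2:
  assumes k: "CARD('k) = 2" and n: "CARD('n) \<ge> 6" and w: "Q w = 1"
  shows "\<exists>x t z. witnesses 1 w x t z"
proof -
  note two = card_2_field(1)[OF k] card_2_field(2)[OF k]
  have double: "a + a = 0" for a :: 'k using two(1)[of a] two(2) by auto
  have alternating: "B a a = 0" for a using two by (simp add: B_self)
  have nz: "a \<noteq> 0 \<longleftrightarrow> a = 1" for a :: 'k using two(1)[of a] by auto
  have neg: "- a = a" for a :: 'k using double[of a] by (simp add: neg_eq_iff_add_eq_0)
  \<comment> \<open>\<open>splitting_insert\<close> cannot apply as \<open>B\<close> is alternating;
    instead w and x are split off together as a pair with pairing 1.\<close>
  have split: "splitting {w, x}" if "B w x = 1" for x
    unfolding splitting_def
  proof
    fix y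
    let ?y = "y + B y x *s w + B y w *s x"
    have "?y \<in> perp {w, x}"
      using that double alternating B_commute[of x w] by (simp add: perp_def form_simps)
    moreover have "\<forall>v\<in>perp {w, x}. B v ?y = B v y" by (auto simp: perp_def form_simps)
    ultimately show "\<exists>y'\<in>perp {w, x}. \<forall>v\<in>perp {w, x}. B v y' = B v y" by blast
  qed
  have "w \<noteq> 0" using w Q_0 by auto
  then obtain x0 where x0: "B w x0 = 1" using ex_B_nonzero nz by blast
  have "card {w, x0} < CARD('n)" using n card_insert_le_m1[of 2 "{x0}" w] by simp
  then obtain a0 where a0: "a0 \<in> perp {w, x0}" "Q a0 = 1"
    using splitting_anisotropic[OF split[OF x0]] nz by blast
  \<comment> \<open>Adding \<open>a0\<close>, of value 1 and orthogonal to w and \<open>x0\<close>,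
    turns value 0 into 1 and keeps the pairing with w.\<close>
  define x where "x = (if Q x0 = 1 then x0 else x0 + a0)"
  have x: "Q x = 1" "B w x = 1"
    using x0 a0 two(1)[of "Q x0"] B_commute by (auto simp: x_def form_simps perp_def)
  have "card {w, x} < CARD('n)" using n card_insert_le_m1[of 2 "{x}" w] by simp
  then obtain a where a: "a \<in> perp {w, x}" "Q a = 1"
    using splitting_anisotropic[OF split[OF x(2)]] nz by blast
  have "a \<noteq> 0" using a Q_0 by auto
  \<comment> \<open>The role of s is to keep a + b nonzero: b is orthogonal to s but a is not. If b
    has value 1, then a + b is singular because a and b are orthogonal.\<close>
  then obtain s where s: "B a s = 1" using ex_B_nonzero nz by blast
  have "card {w, x, a, s} \<le> 4" by (simp add: card_insert_if)
  then obtain b where b: "b \<in> perp {w, x, a, s}" "b \<noteq> 0"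
    using perp_nonzero[of "{w, x, a, s}"] n by auto
  define u where "u = (if Q b = 0 then b else a + b)"
  have "B (a + b) s \<noteq> 0" using b s B_commute[of s] by (simp add: B_add_left perp_def)
  then have "a + b \<noteq> 0" using B_0_left by force
  then have u: "u \<noteq> 0" "Q u = 0" "u \<in> perp {w, x}"
    using a b two(1)[of "Q b"] two(2) B_commute[of a b] by (auto simp: u_def form_simps perp_def)
  obtain z0 where z0: "z0 \<in> perp {w, x}" "B u z0 = 1"
    using splitting_B_nonzero[OF split[OF x(2)] u(3,1)] nz by blast
  \<comment> \<open>As u is singular and pairs to 1 with \<open>z0\<close>, adding it changes the
    value by 1.\<close>
  define z where "z = (if Q z0 = 1 then z0 else z0 + u)"
  have z: "Q z = 1" "z \<in> perp {w, x}" "B z u = 1"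
    using z0 u two(1)[of "Q z0"] B_commute[of z0 u] alternating
    by (auto simp: z_def form_simps perp_def)
  have "x \<noteq> a *s w" for a using x by (auto simp: B_scale_right alternating)
  moreover have "Q (w + x + u) = 1"
    using w x u two(2) B_commute[of x u] B_commute[of w u] by (simp add: form_simps perp_def add.assoc)
  moreover have "B w u = 0" "B x u = 0" "B w z = 0" "B x z = 0" "B z w = 0" "B z x = 0" "B x w = 1"
    using u z x B_commute by (simp_all add: perp_def)
  ultimately have "witnesses 1 w x (w + x + u) z"
    using x z neg[of 1] by (simp add: witnesses_def B_add_right alternating)
  then show ?thesis by blast
qed

text \<open>Two opposite values at e, f make e + f and e - f singular; three equal values do the
  same for \<open>e\<^sub>1 + e\<^sub>2 + e\<^sub>3\<close> and
  \<open>e\<^sub>1 + e\<^sub>2 - e\<^sub>3\<close>, since 3 = 0. The inclusion of complements stands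
  for membership of r and u in the span.\<close>

lemma hyperbolic_pair_card_3:
  assumes k: "CARD('k) = 3" and nz: "Q e\<^sub>1 \<noteq> 0" "Q e\<^sub>2 \<noteq> 0" "Q e\<^sub>3 \<noteq> 0"
    and orth: "B e\<^sub>2 e\<^sub>1 = 0" "B e\<^sub>3 e\<^sub>1 = 0" "B e\<^sub>3 e\<^sub>2 = 0"
  shows "\<exists>r u. Q r = 0 \<and> Q u = 0 \<and> B r u = d \<and> perp {e\<^sub>1, e\<^sub>2, e\<^sub>3} \<subseteq> perp {r, u}"
proof -
  note three = card_3_field(1)[OF k] card_3_field(2)[OF k]
  have orth': "B e\<^sub>1 e\<^sub>2 = 0" "B e\<^sub>1 e\<^sub>3 = 0" "B e\<^sub>2 e\<^sub>3 = 0" using orth B_commute by metis+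
  have "\<exists>r u. Q r = 0 \<and> Q u = 0 \<and> B r u \<noteq> 0 \<and> perp {e\<^sub>1, e\<^sub>2, e\<^sub>3} \<subseteq> perp {r, u}"
  proof -
    have pair: "\<exists>r u. Q r = 0 \<and> Q u = 0 \<and> B r u \<noteq> 0 \<and> perp {e\<^sub>1, e\<^sub>2, e\<^sub>3} \<subseteq> perp {r, u}"
      if "Q e \<noteq> 0" "Q f = - Q e" "B e f = 0" "e \<in> {e\<^sub>1, e\<^sub>2, e\<^sub>3}" "f \<in> {e\<^sub>1, e\<^sub>2, e\<^sub>3}" for e f
    proof -
      have "Q (e + f) = 0" "Q (e - f) = 0" "B (e + f) (e - f) \<noteq> 0"
        using that B_commute[of f e] by (simp_all add: form_simps B_self three(2))
      moreover have "perp {e\<^sub>1, e\<^sub>2, e\<^sub>3} \<subseteq> perp {e + f, e - f}"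
        using that(4,5) by (auto simp: perp_def form_simps)
      ultimately show ?thesis by blast
    qed
    consider "Q e\<^sub>2 = - Q e\<^sub>1" | "Q e\<^sub>3 = - Q e\<^sub>1" | "Q e\<^sub>2 = Q e\<^sub>1" "Q e\<^sub>3 = Q e\<^sub>1"
      using nz three(1)[of "Q e\<^sub>1"] three(1)[of "Q e\<^sub>2"] three(1)[of "Q e\<^sub>3"] by auto
    then show ?thesis
    proof cases
      case 1
      then show ?thesis using pair[of e\<^sub>1 e\<^sub>2] nz orth' by simp
    next
      case 2
      then show ?thesis using pair[of e\<^sub>1 e\<^sub>3] nz orth' by simp
    next
      case 3
      have "Q e\<^sub>1 + Q e\<^sub>1 = - Q e\<^sub>1" using three(2) by (metis mult_2 mult_minus1)
      then have "Q (e\<^sub>1 + e\<^sub>2 + e\<^sub>3) = 0" "Q (e\<^sub>1 + e\<^sub>2 - e\<^sub>3) = 0"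
          "B (e\<^sub>1 + e\<^sub>2 + e\<^sub>3) (e\<^sub>1 + e\<^sub>2 - e\<^sub>3) \<noteq> 0"
        using 3 orth orth' nz by (simp_all add: form_simps B_self three(2))
      moreover have "perp {e\<^sub>1, e\<^sub>2, e\<^sub>3} \<subseteq> perp {e\<^sub>1 + e\<^sub>2 + e\<^sub>3, e\<^sub>1 + e\<^sub>2 - e\<^sub>3}"
        by (auto simp: perp_def form_simps)
      ultimately show ?thesis by blast
    qed
  qed
  then obtain r u where ru: "Q r = 0" "Q u = 0" "B r u \<noteq> 0" "perp {e\<^sub>1, e\<^sub>2, e\<^sub>3} \<subseteq> perp {r, u}"
    by blast
  let ?u = "(d / B r u) *s u"
  have "Q ?u = 0" "B r ?u = d" using ru by (simp_all add: form_simps)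
  moreover have "perp {e\<^sub>1, e\<^sub>2, e\<^sub>3} \<subseteq> perp {r, ?u}" using ru(4) by (auto simp: perp_def form_simps)
  ultimately show ?thesis using ru(1) by blast
qed

text \<open>If neither vector has value c, both have value -c, and their sum has value -2c =
  c.\<close>

lemma represents_card_3:
  assumes k: "CARD('k) = 3" and nz: "Q e \<noteq> 0" "Q f \<noteq> 0" "B e f = 0" and c: "c \<noteq> 0"
  shows "\<exists>v. Q v = c \<and> perp {e, f} \<subseteq> perp {v}"
proof -
  note three = card_3_field(1)[OF k] card_3_field(2)[OF k]
  consider "Q e = c" | "Q f = c" | "Q e = - c" "Q f = - c"
    using nz c three(1)[of "Q e"] three(1)[of "Q f"] three(1)[of c] by auto
  then show ?thesis
  proof cases
    case 1
    then show ?thesis by (intro exI[of _ e]) (auto simp: perp_def)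
  next
    case 2
    then show ?thesis by (intro exI[of _ f]) (auto simp: perp_def)
  next
    case 3
    have "c + c = - c" using three(2) by (metis mult_2 mult_minus1)
    then have "Q (e + f) = c" using 3 nz by (simp add: Q_add)
    then show ?thesis by (intro exI[of _ "e + f"]) (auto simp: perp_def form_simps)
  qed
qed

text \<open>Complete \<open>w\<close> to six orthogonal anisotropic vectors \<open>w, e\<^sub>1, \<dots>, e\<^sub>5\<close>. With a hyperbolic pair
  \<open>r, u\<close> from the span of \<open>e\<^sub>1, e\<^sub>2, e\<^sub>3\<close> and \<open>z\<^sub>0\<close> of value \<open>c\<close> from that of \<open>e\<^sub>4, e\<^sub>5\<close>, take
  \<open>x = w + r\<close>, \<open>t = w + u\<close> and \<open>z = r + z\<^sub>0\<close>.\<close>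

lemma witnesses_card_3:
  assumes k: "CARD('k) = 3" and n: "CARD('n) \<ge> 6" and w: "Q w = c" and c: "c \<noteq> 0"
  shows "\<exists>x t z. witnesses c w x t z"
proof -
  note minus_1 = card_3_field(2)[OF k]
  have self: "B a a = - Q a" for a by (simp add: B_self minus_1)
  have extend: "\<exists>e\<in>perp (set es). Q e \<noteq> 0 \<and> splitting (set (e # es))"
    if es: "splitting (set es)" "length es < 6" for es
  proof -
    have "card (set es) < CARD('n)" using card_length[of es] es n by linarith
    then obtain e where "e \<in> perp (set es)" "Q e \<noteq> 0"
      using splitting_anisotropic es by blast
    then show ?thesis using splitting_insert[of "set es" e] es self by auto
  qed
  have sw: "splitting {w}"
    using splitting_insert[OF splitting_empty, of w] w c self by (simp add: perp_def)
  obtain e1 where e1: "e1 \<in> perp {w}" "Q e1 \<noteq> 0" "splitting {e1, w}"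
    using extend[of "[w]"] sw by auto
  obtain e2 where e2: "e2 \<in> perp {e1, w}" "Q e2 \<noteq> 0" "splitting {e2, e1, w}"
    using extend[of "[e1, w]"] e1 by auto
  obtain e3 where e3: "e3 \<in> perp {e2, e1, w}" "Q e3 \<noteq> 0" "splitting {e3, e2, e1, w}"
    using extend[of "[e2, e1, w]"] e2 by auto
  obtain e4 where e4: "e4 \<in> perp {e3, e2, e1, w}" "Q e4 \<noteq> 0" "splitting {e4, e3, e2, e1, w}"
    using extend[of "[e3, e2, e1, w]"] e3 by auto
  obtain e5 where e5: "e5 \<in> perp {e4, e3, e2, e1, w}" "Q e5 \<noteq> 0"
    using extend[of "[e4, e3, e2, e1, w]"] e4 by auto
  \<comment> \<open>The sign of -c matters: \<open>B x t\<close> becomes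
    \<open>B w w + B r u\<close>, which is -2c = c here but would be 0 for the pairing c.\<close>
  obtain r u where ru: "Q r = 0" "Q u = 0" "B r u = - c" "perp {e1, e2, e3} \<subseteq> perp {r, u}"
    using hyperbolic_pair_card_3[OF k e1(2) e2(2) e3(2), of "- c"] e2(1) e3(1)
    by (auto simp: perp_def)
  obtain z0 where z0: "Q z0 = c" "perp {e4, e5} \<subseteq> perp {z0}"
    using represents_card_3[OF k e4(2) e5(2) _ c] e5(1) B_commute[of e4 e5] by (auto simp: perp_def)
  \<comment> \<open>Complements are used twice: e4 and e5 are orthogonal to r and u, so r and u lie
    in \<open>perp {e4, e5}\<close> and hence in \<open>perp {z0}\<close>.\<close>
  have "w \<in> perp {e1, e2, e3}" "e4 \<in> perp {e1, e2, e3}" "e5 \<in> perp {e1, e2, e3}" "w \<in> perp {e4, e5}"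
    using e1 e2 e3 e4 e5 B_commute[of w] by (auto simp: perp_def)
  then have "w \<in> perp {r, u}" "e4 \<in> perp {r, u}" "e5 \<in> perp {r, u}" "w \<in> perp {z0}"
    using ru(4) z0(2) by blast+
  moreover from this have "r \<in> perp {z0}"
    using B_commute[of r] by (intro subsetD[OF z0(2)]) (simp add: perp_def)
  moreover from calculation have "u \<in> perp {z0}"
    using B_commute[of u] by (intro subsetD[OF z0(2)]) (simp add: perp_def)
  ultimately have orth: "B w r = 0" "B w u = 0" "B w z0 = 0" "B r z0 = 0" "B u z0 = 0"
      "B r w = 0" "B u w = 0" "B z0 w = 0" "B z0 r = 0" "B z0 u = 0" "B u r = - c"
    using ru(3) B_commute by (auto simp: perp_def)
  \<comment> \<open>Pairing with u separates the two sides: the left gives -c, the right 0.\<close>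
  have "w + r \<noteq> a *s w" for a
  proof
    assume "w + r = a *s w"
    then have "B (w + r) u = a * B w u" by (simp add: B_scale_left)
    then show False using orth ru c by (simp add: form_simps)
  qed
  then have "witnesses c w (w + r) (w + u) (r + z0)"
    using w c ru z0(1) orth self by (simp add: witnesses_def form_simps minus_1)
  then show ?thesis by blast
qed


section \<open>The graphs \<open>NO\<close>\<close>

definition pt :: "'k ^ 'n \<Rightarrow> ('k ^ 'n) set" where
  "pt x = vec.span {x}"

lemma mem_pt: "y \<in> pt x \<longleftrightarrow> (\<exists>a. y = a *s x)"
  by (auto simp: pt_def vec.span_singleton)

lemma self_mem_pt: "x \<in> pt x"
  by (auto simp: pt_def intro: vec.span_base)

lemma points_eq: "points = pt ` (- {0})"
proof (intro equalityI subsetI)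
  fix P :: "('k ^ 'n) set"
  assume "P \<in> points"
  then have P: "vec.subspace P" "vec.dim P = 1" by (auto simp: points_def)
  obtain S where S: "S \<subseteq> P" "vec.independent S" "P \<subseteq> vec.span S" "card S = 1"
    using vec.basis_exists[of P] P by metis
  then obtain x where x: "S = {x}" by (auto simp: card_1_singleton_iff)
  then have "x \<noteq> 0" using S vec.dependent_zero by auto
  moreover have "P = pt x"
    using S P x vec.span_minimal[of S P] by (auto simp: pt_def)
  ultimately show "P \<in> pt ` (- {0})" by blast
next
  fix P :: "('k ^ 'n) set"
  assume "P \<in> pt ` (- {0})"
  then obtain x where x: "x \<noteq> 0" "P = pt x" by blast
  then have "vec.dim P = 1"
    using vec.dim_eq_card_independent[of "{x}"] by (simp add: pt_def vec.dim_span)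
  then show "P \<in> points" using x by (simp add: points_def pt_def)
qed

text \<open>Nonzero squares are 1, so a point has a single nonzero value of \<open>Q\<close>; over
  two elements that value can only be c = 1.\<close>

lemma NO_vertices_eq:
  assumes k: "CARD('k) \<in> {2, 3}" and c: "c \<noteq> 0"
  shows "NO_vertices Q c = pt ` {x. Q x = c}"
proof -
  have sq: "square_class c = {c}"
    using card_2_3_field_power2[OF k] by (auto simp: square_class_def intro!: exI[of _ 1])
  have nonsing: "Q x \<noteq> 0 \<longleftrightarrow> Q x = c" if "CARD('k) = 2" for x
    using card_2_field(1)[OF that, of c] card_2_field(1)[OF that, of "Q x"] c by auto
  have "NO_vertices Q c = {P \<in> points. \<forall>x\<in>P. x \<noteq> 0 \<longrightarrow> Q x = c}"
    by (auto simp: NO_vertices_def nonsingular_points_def class_points_def sq nonsing)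
  also have "\<dots> = pt ` {x. x \<noteq> 0 \<and> (\<forall>a. a *s x \<noteq> 0 \<longrightarrow> Q (a *s x) = c)}"
    by (auto simp: points_eq mem_pt)
  also have "{x. x \<noteq> 0 \<and> (\<forall>a. a *s x \<noteq> 0 \<longrightarrow> Q (a *s x) = c)} = {x. Q x = c}"
  proof (intro Collect_cong iffI)
    fix x
    assume "x \<noteq> 0 \<and> (\<forall>a. a *s x \<noteq> 0 \<longrightarrow> Q (a *s x) = c)"
    then show "Q x = c" by (metis vector_smult_lid)
  next
    fix x
    assume "Q x = c"
    then show "x \<noteq> 0 \<and> (\<forall>a. a *s x \<noteq> 0 \<longrightarrow> Q (a *s x) = c)"
      using c Q_0 card_2_3_field_power2[OF k] by (auto simp: Q_scale)
  qed
  finally show ?thesis .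
qed

lemma NO_adj_pt: "NO_adj Q (pt x) (pt y) \<longleftrightarrow> pt x \<noteq> pt y \<and> B x y = 0"
proof -
  have "(\<forall>v\<in>pt x. \<forall>v'\<in>pt y. B v v' = 0) \<longleftrightarrow> B x y = 0"
  proof
    assume "\<forall>v\<in>pt x. \<forall>v'\<in>pt y. B v v' = 0"
    then show "B x y = 0" using self_mem_pt by blast
  next
    assume "B x y = 0"
    then show "\<forall>v\<in>pt x. \<forall>v'\<in>pt y. B v v' = 0"
      by (auto simp: mem_pt B_scale_left B_scale_right)
  qed
  then show ?thesis by (simp add: NO_adj_def)
qed

lemma pt_eqD: "pt x = pt y \<Longrightarrow> \<exists>a. y = a *s x"
  using self_mem_pt[of y] mem_pt[of y x] by simp

text \<open>Orthogonality to v depends only on the point, so v can tell two points apart.\<close>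

lemma pt_neqI: "B x v = 0 \<Longrightarrow> B y v \<noteq> 0 \<Longrightarrow> pt x \<noteq> pt y"
  using pt_eqD[of x y] by (auto simp: B_scale_left)

text \<open>The vertices y and y' of \<open>not_triply_transitiveI\<close> are
  \<open>pt (w + x)\<close> and \<open>pt t\<close>.\<close>

lemma NO_not_triply_transitive:
  assumes k: "CARD('k) \<in> {2, 3}" and n: "CARD('n) \<ge> 6" and c: "c \<noteq> 0"
  shows "\<not> triply_transitive (NO_vertices Q c) (NO_adj Q)"
  unfolding NO_vertices_eq[OF k c]
proof (rule not_triply_transitiveI)
  fix P
  assume "P \<in> pt ` {x. Q x = c}"
  then obtain w where w: "Q w = c" and P: "P = pt w" by blast
  have "\<exists>x t z. witnesses c w x t z"
  proof (cases "CARD('k) = 2")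
    case True
    then show ?thesis using witnesses_card_2[OF True n] card_2_field(1)[OF True, of c] w c by auto
  next
    case False
    then show ?thesis using witnesses_card_3[OF _ n w c] k by auto
  qed
  then obtain x t z where x: "Q x = c" "B w x = - c" "\<And>a. x \<noteq> a *s w"
    and t: "Q t = c" "B w t \<noteq> 0" "B x t \<noteq> 0"
    and z: "Q z = c" "B w z = 0" "B x z = 0" "B z t \<noteq> 0"
    unfolding witnesses_def by blast
  have wx: "Q (w + x) = c" "B w (w + x) = c" "B x (w + x) = c"
    using w x B_commute[of x w] by (simp_all add: form_simps B_self algebra_simps)
  have "pt w \<noteq> pt (w + x)"
  proof
    assume "pt w = pt (w + x)"
    then obtain a where "w + x = a *s w" using pt_eqD by blast
    then have "x = (a - 1) *s w" by (simp add: algebra_simps vector_ssub_ldistrib)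
    then show False using x(3) by blast
  qed
  moreover have "pt x \<noteq> pt (w + x)"
  proof
    assume "pt x = pt (w + x)"
    then obtain a where "w + x = a *s x" using pt_eqD by blast
    then have *: "w = (a - 1) *s x" by (simp add: algebra_simps vector_ssub_ldistrib)
    \<comment> \<open>A zero factor would give w = 0, against the value c of w; dividing by it makes
      x a multiple of w.\<close>
    then have "a - 1 \<noteq> 0" using w c Q_0 by auto
    from left_inverse[OF this] have "inverse (a - 1) *s ((a - 1) *s x) = x"
      by (simp only: vector_smult_assoc vector_smult_lid)
    then have "x = inverse (a - 1) *s w" using * by simp
    then show False using x(3) by blast
  qed
  moreover have "pt w \<noteq> pt t" "pt x \<noteq> pt t"
    using z B_commute[of t z] pt_neqI[of w z t] pt_neqI[of x z t] by auto
  moreover have "pt w \<noteq> pt z" "pt x \<noteq> pt z"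
    using x(2) z c B_commute[of z] B_commute[of x w] pt_neqI[of z x w] pt_neqI[of z w x] by auto
  moreover have "NO_adj Q v (pt (w + x))"
    if v: "v \<in> pt ` {x. Q x = c}" "NO_adj Q (pt w) v" "NO_adj Q (pt x) v" for v
  proof -
    obtain v' where v': "v = pt v'" using v by blast
    then have "B w v' = 0" "B x v' = 0" using v by (auto simp: NO_adj_pt)
    \<comment> \<open>By linearity v' is orthogonal to w + x. The two points differ because w is
      orthogonal to v' but pairs to c with w + x.\<close>
    then show ?thesis
      using wx c v' B_commute[of v'] B_commute[of w "w + x"] pt_neqI[of v' w "w + x"]
      by (simp add: NO_adj_pt B_add_right)
  qed
  moreover have "\<not> NO_adj Q (pt w) (pt (w + x))" "\<not> NO_adj Q (pt x) (pt (w + x))"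
      "\<not> NO_adj Q (pt w) (pt t)" "\<not> NO_adj Q (pt x) (pt t)" "\<not> NO_adj Q (pt z) (pt t)"
    using wx t z c by (simp_all add: NO_adj_pt)
  moreover have "NO_adj Q (pt w) (pt z)" "NO_adj Q (pt x) (pt z)"
    using z \<open>pt w \<noteq> pt z\<close> \<open>pt x \<noteq> pt z\<close> by (simp_all add: NO_adj_pt)
  moreover have "pt x \<in> pt ` {x. Q x = c}" "pt (w + x) \<in> pt ` {x. Q x = c}"
      "pt t \<in> pt ` {x. Q x = c}" "pt z \<in> pt ` {x. Q x = c}"
    using x t z wx by simp_all
  ultimately show "\<exists>x\<in>pt ` {x. Q x = c}. \<exists>y\<in>pt ` {x. Q x = c}. \<exists>y'\<in>pt ` {x. Q x = c}. \<exists>z\<in>pt ` {x. Q x = c}.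
      P \<noteq> y \<and> P \<noteq> y' \<and> x \<noteq> y \<and> x \<noteq> y' \<and>
      \<not> NO_adj Q P y \<and> \<not> NO_adj Q P y' \<and> \<not> NO_adj Q x y \<and> \<not> NO_adj Q x y' \<and>
      (\<forall>v\<in>pt ` {x. Q x = c}. NO_adj Q P v \<longrightarrow> NO_adj Q x v \<longrightarrow> NO_adj Q v y) \<and>
      NO_adj Q P z \<and> NO_adj Q x z \<and> \<not> NO_adj Q z y'"
    unfolding P by (intro bexI[of _ "pt x"] bexI[of _ "pt (w + x)"] bexI[of _ "pt t"]
        bexI[of _ "pt z"] conjI ballI impI)
qed

end

theorem theorem6p16:
  fixes Q :: "('k::{field,finite}) ^ 'n::finite \<Rightarrow> 'k"
    and c :: 'k
    and q m :: nat
    and \<epsilon> :: int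
  assumes "q \<in> {2, 3}" and "CARD('k) = q"
    and "\<epsilon> \<in> {1, -1}"
    and "m \<ge> 3" and "CARD('n) = 2 * m"
    and "quadratic_form Q" and "nondegenerate Q" and "has_type Q \<epsilon>"
    and "c \<noteq> 0"
  shows "\<not> triply_transitive (NO_vertices Q c) (NO_adj Q)"
proof -
  interpret quadratic_space Q by standard (use assms in auto)
  show ?thesis using assms by (intro NO_not_triply_transitive) auto
qed

end
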